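(* Let $k,n$ be positive integers with $n\equiv 0\pmod 2$. Then $$\beta_{n,k,q}^{\ast}=\left(\frac{1}{1-q}\right)^{n-1}\sum_{m=0}^{n}\binom{n}{m}\frac{(-1)^{m}\,m\,q^{\frac{(n-1)(k-1)}{2}+k+m-2}}{\left(1-q^{m-\frac{n-1}{2}-2}\right)\left(1-q^{m-\frac{n-1}{2}}\right)}.$$
   Context: $q$ is an indeterminate with a fixed square root $q^{1/2}$; identities are in the field $\mathbb{C}(q^{1/2})$ of rational functions in $q^{1/2}$. For an integer $j$, $[j]_q=\frac{q^j-1}{q-1}$ and $[j]_{q^2}=\frac{q^{2j}-1}{q^2-1}$. The numbers $\beta_{n,k,q}^{\ast}$ ($q$-Bernoulli numbers) are defined by the formal generating function $$F_{k,q}^{\ast}(t)=-t\sum_{j=0}^{\infty}q^{k-j}[j]_{q^{2}}\exp\left(t[j]_{q}q^{\frac{k-j}{2}}\right)=\sum_{n=0}^{\infty}\frac{\beta_{n,k,q}^{\ast}t^{n}}{n!},$$ i.e., comparing coefficients of $t^n/n!$ for $n\ge 1$, $$\beta_{n,k,q}^{\ast}=-n\sum_{j=0}^{\infty}[j]_{q^2}[j]_q^{n-1}q^{\frac{(n+1)(k-j)}{2}}.$$ Convention for the infinite sum over $j$: the summand is expanded (by the binomial theorem) as a finite linear combination $\sum_i a_i q^{c_i j}$ with distinct $c_i\in\frac12\mathbb{Z}$ and $a_i\in\mathbb{C}(q^{1/2})$ independent of $j$, and the sum over $j\ge 0$ is evaluated termwise by the formal geometric series rule $\sum_{j\ge0}q^{cj}:=\frac{1}{1-q^{c}}$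 ($c\neq 0$), so that its value is $\sum_i \frac{a_i}{1-q^{c_i}}\in\mathbb{C}(q^{1/2})$. For even $n\geq 2$ all exponents $c_i$ lie in $\frac12+\mathbb{Z}$, so they are nonzero and this is well defined. *)

theory Defs
  imports "HOL-Computational_Algebra.Computational_Algebra"
begin

instance fract :: ("{idom, ring_char_0}") field_char_0
proof
  have of_nat_fract: "(of_nat n :: 'a fract) = to_fract (of_nat n)" for n
    by (induction n) auto
  show "inj (of_nat :: nat \<Rightarrow> 'a fract)"
    by (rule injI) (simp add: of_nat_fract)
qed

text \<open>
  The field \<open>\<complex>(q\<^sup>1\<^sup>/\<^sup>2)\<close> is the fraction field of \<open>\<complex>[X]\<close>, with \<open>X\<close> in the role of \<open>q\<^sup>1\<^sup>/\<^sup>2\<close>.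
  A half-integral power \<open>q\<^sup>c\<close> is therefore \<open>sqrt_q powi (2 * c)\<close>.
\<close>

type_synonym ratfun = "complex poly fract"

definition sqrt_q :: ratfun where
  "sqrt_q = to_fract [:0, 1:]"

definition q :: ratfun where
  "q = sqrt_q ^ 2"

definition q_int :: "'a::field \<Rightarrow> int \<Rightarrow> 'a" where
  "q_int x j = (x powi j - 1) / (x - 1)"

text \<open>
  Formal summation over \<open>j \<ge> 0\<close>: the summand is written as a finite linear combination of
  the functions \<open>j \<mapsto> q\<^sup>c\<^sup>j\<close> for distinct nonzero \<open>c \<in> \<half>\<int>\<close>, and \<open>\<Sum>\<^sub>j q\<^sup>c\<^sup>j\<close> is evaluated as
  \<open>1 / (1 - q\<^sup>c)\<close>. Below, \<open>C\<close> is the set of the doubled exponents \<open>2 * c\<close>. By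
  \<open>has_formal_sum_unique\<close> the value does not depend on the chosen expansion. For summands without
  such an expansion, \<open>formal_sum\<close> is unspecified.
\<close>

definition has_formal_sum :: "(nat \<Rightarrow> ratfun) \<Rightarrow> ratfun \<Rightarrow> bool" where
  "has_formal_sum f v \<longleftrightarrow>
     (\<exists>C a. finite C \<and> 0 \<notin> C \<and>
        (\<forall>j. f j = (\<Sum>c\<in>C. a c * sqrt_q powi (c * int j))) \<and>
        v = (\<Sum>c\<in>C. a c / (1 - sqrt_q powi c)))"

definition formal_sum :: "(nat \<Rightarrow> ratfun) \<Rightarrow> ratfun" where
  "formal_sum f = (THE v. has_formal_sum f v)"

lemma sqrt_q_nonzero: "sqrt_q \<noteq> 0"
  by (simp add: sqrt_q_def)

lemma sqrt_q_power: "sqrt_q ^ n = to_fract (monom 1 n)"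
  by (induction n) (simp_all add: sqrt_q_def monom_0 monom_Suc flip: to_fract_mult one_pCons)

lemma sqrt_q_powi_inj: "inj (\<lambda>c. sqrt_q powi c)"
proof (rule injI)
  have *: "c = d" if "c \<le> d" "sqrt_q powi c = sqrt_q powi d" for c d :: int
  proof -
    have "sqrt_q powi (d - c) = 1"
      using that sqrt_q_nonzero by (simp add: power_int_diff)
    hence "sqrt_q ^ nat (d - c) = sqrt_q ^ 0"
      using that by (simp add: power_int_def)
    hence "monom (1 :: complex) (nat (d - c)) = monom 1 0"
      by (simp only: sqrt_q_power to_fract_eq_iff)
    hence "degree (monom (1 :: complex) (nat (d - c))) = degree (monom (1 :: complex) 0)"
      by simp
    hence "nat (d - c) = 0"
      by (simp add: degree_monom_eq)
    thus ?thesis using that by simp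
  qed
  show "c = d" if "sqrt_q powi c = sqrt_q powi d" for c d :: int
    using *[of c d] *[of d c] that by (cases "c \<le> d") auto
qed

lemma geometric_independent:
  assumes "finite C" "\<And>j :: nat. (\<Sum>c\<in>C. b c * sqrt_q powi (c * int j)) = 0" "c \<in> C"
  shows "b c = 0"
  using assms
proof (induction C arbitrary: b c rule: finite_induct)
  case empty
  thus ?case by simp
next
  case (insert d C)
  have *: "b c = 0" if "c \<in> C" for c
  proof -
    have "(\<Sum>c\<in>C. (b c * (sqrt_q powi c - sqrt_q powi d)) * sqrt_q powi (c * int j)) = 0" for j
    proof -
      have "0 = (\<Sum>c\<in>insert d C. b c * sqrt_q powi (c * int (Suc j)))
              - sqrt_q powi d * (\<Sum>c\<in>insert d C. b c * sqrt_q powi (c * int j))"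
        using insert.prems(1)[of j] insert.prems(1)[of "Suc j"] by (simp only: mult_zero_right diff_0_right)
      also have "\<dots> = (\<Sum>c\<in>insert d C.
          (b c * (sqrt_q powi c - sqrt_q powi d)) * sqrt_q powi (c * int j))"
        unfolding sum_distrib_left sum_subtractf[symmetric] using sqrt_q_nonzero
        by (intro sum.cong) (simp_all add: algebra_simps power_int_add)
      also have "\<dots> = (\<Sum>c\<in>C.
          (b c * (sqrt_q powi c - sqrt_q powi d)) * sqrt_q powi (c * int j))"
        using insert.hyps by simp
      finally show ?thesis by simp
    qed
    from insert.IH[OF this that] have "b c * (sqrt_q powi c - sqrt_q powi d) = 0" .
    moreover have "c \<noteq> d" using that insert.hyps by auto
    ultimately show ?thesis using sqrt_q_powi_inj by (auto dest: injD)
  qed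
  have "b d = 0"
    using insert.prems(1)[of 0] insert.hyps * by simp
  thus ?case using * insert.prems(2) by auto
qed

lemma has_formal_sum_unique:
  assumes "has_formal_sum f v" "has_formal_sum f w"
  shows "v = w"
proof -
  obtain C a where C: "finite C" "\<And>j. f j = (\<Sum>c\<in>C. a c * sqrt_q powi (c * int j))"
      "v = (\<Sum>c\<in>C. a c / (1 - sqrt_q powi c))"
    using assms(1) unfolding has_formal_sum_def by blast
  obtain D b where D: "finite D" "\<And>j. f j = (\<Sum>c\<in>D. b c * sqrt_q powi (c * int j))"
      "w = (\<Sum>c\<in>D. b c / (1 - sqrt_q powi c))"
    using assms(2) unfolding has_formal_sum_def by blast
  define a' where "a' c = (if c \<in> C then a c else 0)" for c
  define b' where "b' c = (if c \<in> D then b c else 0)" for c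
  have a': "(\<Sum>c\<in>C. a c * g c) = (\<Sum>c\<in>C \<union> D. a' c * g c)" for g :: "int \<Rightarrow> ratfun"
    using C(1) D(1) by (intro sum.mono_neutral_cong_left) (auto simp: a'_def)
  have b': "(\<Sum>c\<in>D. b c * g c) = (\<Sum>c\<in>C \<union> D. b' c * g c)" for g :: "int \<Rightarrow> ratfun"
    using C(1) D(1) by (intro sum.mono_neutral_cong_left) (auto simp: b'_def)
  have "(\<Sum>c\<in>C \<union> D. (a' c - b' c) * sqrt_q powi (c * int j)) = 0" for j
    using C(2)[of j] D(2)[of j] by (simp add: a' b' left_diff_distrib sum_subtractf)
  hence eq: "a' c = b' c" if "c \<in> C \<union> D" for c
    using geometric_independent[of "C \<union> D" "\<lambda>c. a' c - b' c" c] C(1) D(1) that by simp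
  have "v = (\<Sum>c\<in>C \<union> D. a' c * inverse (1 - sqrt_q powi c))"
    unfolding C(3) divide_inverse by (rule a')
  also have "\<dots> = (\<Sum>c\<in>C \<union> D. b' c * inverse (1 - sqrt_q powi c))"
    by (intro sum.cong) (simp_all add: eq)
  also have "\<dots> = w"
    unfolding D(3) divide_inverse by (rule b'[symmetric])
  finally show ?thesis .
qed

lemma formal_sum_eq: "has_formal_sum f v \<Longrightarrow> formal_sum f = v"
  unfolding formal_sum_def by (blast intro: has_formal_sum_unique)

text \<open>Formal sums of power series in \<open>t\<close> are taken coefficientwise.\<close>

definition fps_formal_sum :: "(nat \<Rightarrow> ratfun fps) \<Rightarrow> ratfun fps" where
  "fps_formal_sum G = Abs_fps (\<lambda>n. formal_sum (\<lambda>j. fps_nth (G j) n))"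

definition F_star :: "nat \<Rightarrow> ratfun fps" where
  "F_star k = - fps_X * fps_formal_sum (\<lambda>j.
     fps_const (q powi (int k - int j) * q_int (q ^ 2) (int j)) *
     fps_exp (q_int q (int j) * sqrt_q powi (int k - int j)))"

definition beta_star :: "nat \<Rightarrow> nat \<Rightarrow> ratfun" where
  "beta_star n k = fact n * fps_nth (F_star k) n"

lemma beta_star_explicit:
  assumes "n \<ge> 1"
    and "has_formal_sum (\<lambda>j. q_int (q ^ 2) (int j) * q_int q (int j) ^ (n - 1) *
           sqrt_q powi ((int n + 1) * (int k - int j))) v"
  shows "beta_star n k = - (of_nat n * v)"
proof -
  obtain m where n: "n = Suc m"
    using assms(1) by (cases n) auto
  obtain C a where C: "finite C" "0 \<notin> C"
      "\<And>j. q_int (q ^ 2) (int j) * q_int q (int j) ^ m *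
           sqrt_q powi ((int n + 1) * (int k - int j)) = (\<Sum>c\<in>C. a c * sqrt_q powi (c * int j))"
      "v = (\<Sum>c\<in>C. a c / (1 - sqrt_q powi c))"
    using assms(2) unfolding has_formal_sum_def n by auto
  have pow: "q powi i * (sqrt_q powi i) ^ m = sqrt_q powi ((int n + 1) * i)" for i
  proof -
    have "(int n + 1) * i = 2 * i + i * int m"
      by (simp add: n algebra_simps)
    hence "sqrt_q powi ((int n + 1) * i) = sqrt_q powi (2 * i) * sqrt_q powi (i * int m)"
      using sqrt_q_nonzero by (simp only: power_int_add simp_thms)
    also have "sqrt_q powi (2 * i) = q powi i"
      by (simp add: q_def power_int_mult)
    also have "sqrt_q powi (i * int m) = (sqrt_q powi i) ^ m"
      by (simp only: power_int_mult power_int_of_nat)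
    finally show ?thesis ..
  qed
  have "has_formal_sum (\<lambda>j. fps_nth
     (fps_const (q powi (int k - int j) * q_int (q ^ 2) (int j)) *
     fps_exp (q_int q (int j) * sqrt_q powi (int k - int j))) m) (v / fact m)"
    unfolding has_formal_sum_def
  proof (intro exI conjI allI)
    show "v / fact m = (\<Sum>c\<in>C. (a c / fact m) / (1 - sqrt_q powi c))"
      unfolding C(4) sum_divide_distrib by (intro sum.cong) (simp_all add: field_simps)
    fix j
    have "fps_nth (fps_const (q powi (int k - int j) * q_int (q ^ 2) (int j)) *
       fps_exp (q_int q (int j) * sqrt_q powi (int k - int j))) m =
       q_int (q ^ 2) (int j) * q_int q (int j) ^ m *
         (q powi (int k - int j) * (sqrt_q powi (int k - int j)) ^ m) / fact m"
      by (simp add: power_mult_distrib mult_ac)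
    also have "\<dots> = (\<Sum>c\<in>C. a c * sqrt_q powi (c * int j)) / fact m"
      unfolding pow C(3) ..
    also have "\<dots> = (\<Sum>c\<in>C. a c / fact m * sqrt_q powi (c * int j))"
      by (simp add: sum_divide_distrib)
    finally show "fps_nth (fps_const (q powi (int k - int j) * q_int (q ^ 2) (int j)) *
       fps_exp (q_int q (int j) * sqrt_q powi (int k - int j))) m =
       (\<Sum>c\<in>C. a c / fact m * sqrt_q powi (c * int j))" .
  qed (use C in auto)
  from formal_sum_eq[OF this] show ?thesis
    by (simp add: beta_star_def F_star_def fps_formal_sum_def n mult.assoc)
qed

end

theory Submission
  imports Defs
begin

text \<open>
  Put \<open>n = p + 1\<close>. Expanding \<open>(1 - q\<^sup>j)\<^sup>p\<close> by the binomial theorem and \<open>1 - q\<^sup>2\<^sup>j\<close> into its two terms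
  writes the summand of \<open>\<beta>\<^sup>*\<close> as a combination of pairs \<open>q\<^sup>a\<^sup>j - q\<^sup>b\<^sup>j\<close> with
  \<open>a = l - (n + 1) / 2\<close> and \<open>b = a + 2\<close>, one for each \<open>l \<le> p\<close>. As \<open>n\<close> is even, neither exponent
  vanishes, and such a pair sums to
  \<open>1 / (1 - q\<^sup>a) - 1 / (1 - q\<^sup>b) = q\<^sup>a (1 - q\<^sup>2) / ((1 - q\<^sup>a) (1 - q\<^sup>b))\<close>, where \<open>1 - q\<^sup>2\<close> cancels the
  denominator of \<open>[j]\<close> to the base \<open>q\<^sup>2\<close>. This is \<open>summand_has_formal_sum\<close>. The claim is the
  same sum indexed by \<open>m = l + 1\<close>: the prefactor \<open>-n\<close> is absorbed by \<open>n (p choose l) = m (n choose m)\<close>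
  and \<open>-(-1)\<^sup>l = (-1)\<^sup>m\<close>, and the factor \<open>m\<close> makes the additional index \<open>m = 0\<close> harmless.

  For \<open>n > 2\<close> the exponents \<open>b\<close> of some pairs are the exponents \<open>a\<close> of others, whereas a formal sum
  is read off from an expansion with distinct exponents. Hence \<open>has_formal_sum_geometric\<close>, which allows repetitions.
\<close>

lemma one_minus_sqrt_q_powi_nonzero: "c \<noteq> 0 \<Longrightarrow> 1 - sqrt_q powi c \<noteq> 0"
  using sqrt_q_powi_inj by (auto dest: injD[where y = 0])

text \<open>Collecting the terms with a common exponent turns an arbitrary expansion into one with
  distinct exponents, and evaluation term by term is additive in the coefficients.\<close>

lemma has_formal_sum_geometric:
  assumes "finite I" "\<And>i. i \<in> I \<Longrightarrow> e i \<noteq> 0"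
  shows "has_formal_sum (\<lambda>j. \<Sum>i\<in>I. b i * sqrt_q powi (e i * int j))
           (\<Sum>i\<in>I. b i / (1 - sqrt_q powi e i))"
proof -
  define a where "a c = (\<Sum>i | i \<in> I \<and> e i = c. b i)" for c
  have collect: "(\<Sum>i\<in>I. b i * g (e i)) = (\<Sum>c\<in>e ` I. a c * g c)" for g :: "int \<Rightarrow> ratfun"
    unfolding sum.image_gen[OF assms(1), of _ e] a_def sum_distrib_right by simp
  show ?thesis
    unfolding has_formal_sum_def
  proof (intro exI conjI allI)
    show "(\<Sum>i\<in>I. b i * sqrt_q powi (e i * int j)) = (\<Sum>c\<in>e ` I. a c * sqrt_q powi (c * int j))"
      for j by (rule collect)
    show "(\<Sum>i\<in>I. b i / (1 - sqrt_q powi e i)) = (\<Sum>c\<in>e ` I. a c / (1 - sqrt_q powi c))"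
      unfolding divide_inverse by (rule collect)
  qed (use assms in auto)
qed

text \<open>Both families of exponents may overlap; indexing them by a disjoint union reduces the
  difference to the previous lemma.\<close>

lemma has_formal_sum_geometric_diff:
  assumes "finite I" "\<And>i. i \<in> I \<Longrightarrow> d i \<noteq> 0" "\<And>i. i \<in> I \<Longrightarrow> e i \<noteq> 0"
  shows "has_formal_sum
           (\<lambda>j. \<Sum>i\<in>I. b i * (sqrt_q powi (d i * int j) - sqrt_q powi (e i * int j)))
           (\<Sum>i\<in>I. b i * (1 / (1 - sqrt_q powi d i) - 1 / (1 - sqrt_q powi e i)))"
proof -
  have "case_sum d e i \<noteq> 0" if "i \<in> I <+> I" for i
    using that assms by auto
  with assms(1) have "has_formal_sum
      (\<lambda>j. \<Sum>i\<in>I <+> I. case_sum b (\<lambda>i. - b i) i * sqrt_q powi (case_sum d e i * int j))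
      (\<Sum>i\<in>I <+> I. case_sum b (\<lambda>i. - b i) i / (1 - sqrt_q powi case_sum d e i))"
    by (intro has_formal_sum_geometric) auto
  thus ?thesis
    using assms(1) by (simp add: sum.Plus sum_negf sum_subtractf right_diff_distrib)
qed

lemma q_powi: "q powi c = sqrt_q powi (2 * c)"
  by (simp add: q_def power_int_mult)

text \<open>Since \<open>p\<close> is odd, so are the doubled exponents of all geometric progressions in the summand, and none
  of them is constant. The shift from \<open>k\<close> to \<open>k - 1\<close> comes from the numerator that remains when the two
  geometric sums of a pair are subtracted.\<close>

lemma summand_has_formal_sum:
  assumes "odd p"
  shows "has_formal_sum
    (\<lambda>j. q_int (q ^ 2) (int j) * q_int q (int j) ^ p * sqrt_q powi ((int p + 2) * (int k - int j)))
    ((1 / (1 - q)) ^ p *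
      (\<Sum>l\<le>p. of_nat (p choose l) * (-1) ^ l * sqrt_q powi ((int p + 2) * (int k - 1) + 2 * int l) /
        ((1 - sqrt_q powi (2 * int l - int p - 2)) * (1 - sqrt_q powi (2 * int l - int p + 2)))))"
    (is "has_formal_sum ?f ?v")
proof -
  define K where "K = sqrt_q powi ((int p + 2) * int k) / ((1 - q ^ 2) * (1 - q) ^ p)"
  define b where "b l = K * (of_nat (p choose l) * (-1) ^ l)" for l
  \<comment> \<open>the doubled exponents of a pair of progressions; they differ by 4, that is, by the ratio \<open>q ^ 2\<close>\<close>
  define d where "d l = 2 * int l - int p - 2" for l :: nat
  define e where "e l = 2 * int l - int p + 2" for l :: nat
  have odd: "odd (d l)" "odd (e l)" for l
    using assms by (auto simp: d_def e_def)
  have nz: "d l \<noteq> 0" "e l \<noteq> 0" for l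
    using odd[of l] by auto
  have q2: "1 - q ^ 2 \<noteq> 0"
    using one_minus_sqrt_q_powi_nonzero[of 4] by (simp add: q_def power_int_def flip: power_mult)
  have f: "?f j = (\<Sum>l\<le>p. b l * (sqrt_q powi (d l * int j) - sqrt_q powi (e l * int j)))" for j
  proof -
    define Y where "Y = sqrt_q powi (2 * int j)"
    define Z where "Z = sqrt_q powi (- (int p + 2) * int j)"
    have Y: "q powi int j = Y" "(q ^ 2) powi int j = Y ^ 2"
      unfolding Y_def by (simp_all only: power2_eq_square power_int_mult_distrib q_powi)
    have d: "sqrt_q powi (d l * int j) = Z * Y ^ l" for l
    proof -
      have "d l * int j = - (int p + 2) * int j + 2 * int j * int l"
        by (simp add: d_def algebra_simps)
      thus ?thesis
        using sqrt_q_nonzero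
        by (simp only: power_int_add Y_def Z_def power_int_mult[of _ "2 * int j"] power_int_of_nat simp_thms)
    qed
    have e: "sqrt_q powi (e l * int j) = Z * Y ^ l * Y ^ 2" for l
    proof -
      have "e l * int j = d l * int j + 2 * int j * int 2"
        by (simp add: d_def e_def algebra_simps)
      thus ?thesis
        using sqrt_q_nonzero
        by (simp only: power_int_add d Y_def power_int_mult[of _ "2 * int j"] power_int_of_nat simp_thms)
    qed
    have "sqrt_q powi ((int p + 2) * (int k - int j)) = sqrt_q powi ((int p + 2) * int k) * Z"
    proof -
      have "(int p + 2) * (int k - int j) = (int p + 2) * int k + - (int p + 2) * int j"
        by (simp add: algebra_simps)
      thus ?thesis
        using sqrt_q_nonzero by (simp only: power_int_add Z_def simp_thms)
    qed
    moreover have "q_int (q ^ 2) (int j) = (1 - Y ^ 2) / (1 - q ^ 2)"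
      unfolding q_int_def Y by (metis minus_diff_eq minus_divide_divide)
    moreover have "q_int q (int j) = (1 - Y) / (1 - q)"
      unfolding q_int_def Y by (metis minus_diff_eq minus_divide_divide)
    ultimately have "?f j = K * Z * (1 - Y ^ 2) * (1 - Y) ^ p"
      by (simp add: K_def power_divide)
    also have "(1 - Y) ^ p = (\<Sum>l\<le>p. of_nat (p choose l) * (-1) ^ l * Y ^ l)"
      using binomial_ring[of "- Y" 1 p] by (simp add: power_minus[of Y] mult.assoc)
    finally show ?thesis
      unfolding d e by (simp add: b_def sum_distrib_left algebra_simps)
  qed
  have v: "?v = (\<Sum>l\<le>p. b l * (1 / (1 - sqrt_q powi d l) - 1 / (1 - sqrt_q powi e l)))"
    unfolding sum_distrib_left
  proof (rule sum.cong)
    fix l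
    have e: "sqrt_q powi e l = sqrt_q powi d l * q ^ 2"
    proof -
      have "e l = d l + int 4" by (simp add: d_def e_def)
      thus ?thesis
        using sqrt_q_nonzero by (simp only: power_int_add power_int_of_nat simp_thms)
          (simp add: q_def flip: power_mult)
    qed
    have exponents: "sqrt_q powi ((int p + 2) * (int k - 1) + 2 * int l) =
        sqrt_q powi ((int p + 2) * int k) * sqrt_q powi d l"
    proof -
      have "(int p + 2) * (int k - 1) + 2 * int l = (int p + 2) * int k + d l"
        by (simp add: d_def algebra_simps)
      thus ?thesis
        using sqrt_q_nonzero by (simp only: power_int_add simp_thms)
    qed
    have "1 / (1 - sqrt_q powi d l) - 1 / (1 - sqrt_q powi e l) =
        sqrt_q powi d l * (1 - q ^ 2) / ((1 - sqrt_q powi d l) * (1 - sqrt_q powi e l))"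
      using nz[THEN one_minus_sqrt_q_powi_nonzero, of l]
      by (simp add: diff_frac_eq) (simp add: e algebra_simps)
    thus "(1 / (1 - q)) ^ p * (of_nat (p choose l) * (-1) ^ l *
        sqrt_q powi ((int p + 2) * (int k - 1) + 2 * int l) /
        ((1 - sqrt_q powi (2 * int l - int p - 2)) * (1 - sqrt_q powi (2 * int l - int p + 2)))) =
        b l * (1 / (1 - sqrt_q powi d l) - 1 / (1 - sqrt_q powi e l))"
      using q2 unfolding exponents d_def[symmetric] e_def[symmetric]
      by (simp add: b_def K_def power_divide mult_ac)
  qed simp
  show ?thesis
    unfolding f v by (rule has_formal_sum_geometric_diff) (use nz in auto)
qed

theorem theorem1:
  fixes k n :: nat
  assumes "k > 0" and "n > 0" and "even n"
  shows "beta_star n k =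
    (1 / (1 - q)) ^ (n - 1) *
    (\<Sum>m=0..n. of_nat (n choose m) *
      ((-1) ^ m * of_nat m *
         (sqrt_q powi ((int n - 1) * (int k - 1)) * q powi (int k + int m - 2)) /
       ((1 - sqrt_q powi (2 * int m - (int n - 1) - 4)) *
        (1 - sqrt_q powi (2 * int m - (int n - 1))))))"
proof -
  obtain p where n: "n = Suc p"
    using assms(2) by (cases n) auto
  have "odd p"
    using assms(3) by (simp add: n)
  define D where "D l = (1 - sqrt_q powi (2 * int l - int p - 2)) *
    (1 - sqrt_q powi (2 * int l - int p + 2))" for l
  define E where "E l = sqrt_q powi ((int p + 2) * (int k - 1) + 2 * int l)" for l
  define T where "T m = of_nat (n choose m) *
      ((-1) ^ m * of_nat m *
         (sqrt_q powi ((int n - 1) * (int k - 1)) * q powi (int k + int m - 2)) /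
       ((1 - sqrt_q powi (2 * int m - (int n - 1) - 4)) *
        (1 - sqrt_q powi (2 * int m - (int n - 1)))))" for m
  have T: "T (Suc l) = - (of_nat n * (of_nat (p choose l) * (-1) ^ l * E l / D l))" for l
  proof -
    have absorb: "of_nat (n choose Suc l) * of_nat (Suc l) = (of_nat n * of_nat (p choose l) :: ratfun)"
      using Suc_times_binomial[of l p] unfolding n
      by (metis of_nat_mult mult.commute)
    have "(int n - 1) * (int k - 1) + 2 * (int k + int (Suc l) - 2) =
        (int p + 2) * (int k - 1) + 2 * int l"
      by (simp add: n algebra_simps)
    hence E: "sqrt_q powi ((int n - 1) * (int k - 1)) * q powi (int k + int (Suc l) - 2) = E l"
      unfolding q_powi E_def using sqrt_q_nonzero by (metis power_int_add)
    have D: "(1 - sqrt_q powi (2 * int (Suc l) - (int n - 1) - 4)) *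
        (1 - sqrt_q powi (2 * int (Suc l) - (int n - 1))) = D l"
      by (simp add: D_def n algebra_simps)
    have "T (Suc l) = of_nat (n choose Suc l) * of_nat (Suc l) * ((-1) ^ Suc l * E l / D l)"
      unfolding T_def E D by (simp only: times_divide_eq_right mult_ac)
    thus ?thesis
      unfolding absorb by simp
  qed
  have "beta_star n k =
      - (of_nat n * ((1 / (1 - q)) ^ p * (\<Sum>l\<le>p. of_nat (p choose l) * (-1) ^ l * E l / D l)))"
    unfolding D_def E_def
    using summand_has_formal_sum[OF \<open>odd p\<close>, of k] by (intro beta_star_explicit) (simp_all add: n add_ac)
  also have "\<dots> = (1 / (1 - q)) ^ p * (\<Sum>l\<le>p. T (Suc l))"
    unfolding T sum_negf sum_distrib_left[symmetric] by (simp add: mult_ac)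
  also have "(\<Sum>l\<le>p. T (Suc l)) = (\<Sum>m=0..n. T m)"
    unfolding n atLeast0AtMost sum.atMost_Suc_shift[of T] by (simp add: T_def)
  finally show ?thesis
    by (simp add: T_def n)
qed

end
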